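(* Let $\xi$ and $\tilde{\xi}$ be trajectories with cost feature vectors $\mathbf{f}(\xi),\mathbf{f}(\tilde{\xi})\in\mathbb{R}^K_{\ge 0}$. Suppose there exists $\boldsymbol{\alpha}=(\alpha_1,\dots,\alpha_K)$ with $\alpha_k>0$ for every $k$ such that $$\mathrm{subdom}_{\boldsymbol{\alpha}}(\xi,\tilde{\xi})=\sum_{k=1}^K\left[\alpha_k\left(f_k(\xi)-f_k(\tilde{\xi})\right)+1\right]_+=0 .$$ Then $\xi\in\mathrm{Satisf}_{\tilde{\xi}}$. That is, if $\Omega$ is the aspiration set of the demonstration $\tilde{\xi}$, i.e. any set of full-trajectory aspirations in the admissible class of cost functions that $\tilde{\xi}$ itself satisfices, then $\xi$ satisfices $\Omega$.
   Context: Notation: $[x]_+=\max(x,0)$. A trajectory is a finite sequence of states and actions. Each trajectory $\xi$ has a cost feature vector $\mathbf{f}(\xi)=(f_1(\xi),\dots,f_K(\xi))\in\mathbb{R}^K_{\ge0}$. Admissible cost functions: $\mathrm{cost}_{\mathbf w}(\xi)=\sum_{k} w_k\, g_k(f_k(\xi))$ with weights $w_k\ge 0$ and monotonically non-decreasing functions $g_k:\mathbb{R}_{\ge 0}\to\mathbb{R}$ (nonnegative linear functions of monotone transformations of the cost features). The $g_k$ may differ between aspirations. Aspirations: a full-trajectory aspiration is a pair consisting of an admissible cost function $\mathrm{cost}_{\mathbf w}$ and a threshold $\nu\in\mathbb{R}$. A trajectory $\xi$ satisfices (is acceptable for) it if and only if $\mathrm{cost}_{\mathbf w}(\xi)<\nu$,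 where the cost is evaluated on the full trajectory. A trajectory satisfices an aspiration set $\Omega$ (written $\xi\in\mathrm{Satisf}_\Omega$) if and only if it satisfices every aspiration in $\Omega$. Each demonstration $\tilde{\xi}$ has a corresponding (unknown) aspiration set $\Omega_{\tilde\xi}$, which it satisfices. $\mathrm{Satisf}_{\tilde\xi}$ denotes $\mathrm{Satisf}_{\Omega_{\tilde\xi}}$. *)

theory Defs
  imports "HOL-Analysis.Finite_Cartesian_Product"
begin

(* Arbitrary finite sequences of states (Inl) and actions (Inr); no alternation is imposed. *)
type_synonym ('s, 'a) trajectory = "('s + 'a) list"

(* 'k indexes the K cost features *)
type_synonym ('s, 'a, 'k) cost_features = "('s, 'a) trajectory \<Rightarrow> real ^ 'k"

definition pos_part :: "real \<Rightarrow> real" where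
  "pos_part x = max x 0"

definition subdom ::
  "('s, 'a, 'k::finite) cost_features \<Rightarrow> real ^ 'k \<Rightarrow> ('s, 'a) trajectory \<Rightarrow> ('s, 'a) trajectory \<Rightarrow> real"
where
  "subdom f \<alpha> \<xi> \<xi>' = (\<Sum>k\<in>UNIV. pos_part (\<alpha> $ k * (f \<xi> $ k - f \<xi>' $ k) + 1))"

definition cost ::
  "('s, 'a, 'k::finite) cost_features \<Rightarrow> real ^ 'k \<Rightarrow> ('k \<Rightarrow> real \<Rightarrow> real) \<Rightarrow> ('s, 'a) trajectory \<Rightarrow> real"
where
  "cost f w g \<xi> = (\<Sum>k\<in>UNIV. w $ k * g k (f \<xi> $ k))"

(* The transformations g k are functions on the nonnegative reals, hence monotonicity only on
   {0..}; their values on negative arguments are irrelevant when the features are nonnegative. *)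
definition admissible_costs ::
  "('s, 'a, 'k::finite) cost_features \<Rightarrow> (('s, 'a) trajectory \<Rightarrow> real) set"
where
  "admissible_costs f =
     {cost f w g | w g. (\<forall>k. 0 \<le> w $ k) \<and> (\<forall>k. mono_on {0..} (g k))}"

type_synonym ('s, 'a) aspiration = "(('s, 'a) trajectory \<Rightarrow> real) \<times> real"

definition aspirations :: "('s, 'a, 'k::finite) cost_features \<Rightarrow> ('s, 'a) aspiration set" where
  "aspirations f = admissible_costs f \<times> UNIV"

definition satisfices :: "('s, 'a) trajectory \<Rightarrow> ('s, 'a) aspiration \<Rightarrow> bool" where
  "satisfices \<xi> A \<longleftrightarrow> fst A \<xi> < snd A"

definition Satisf :: "('s, 'a) aspiration set \<Rightarrow> ('s, 'a) trajectory set" where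
  "Satisf \<Omega> = {\<xi>. \<forall>A\<in>\<Omega>. satisfices \<xi> A}"

end

theory Submission
  imports Defs
begin

text \<open>A sum of hinge terms vanishes only if each term does, so zero subdominance forces every
  feature gap, scaled by a positive \<alpha>, to be at most -1. Hence \<xi> beats the demonstration
  \<xi>' strictly in every feature (\<open>subdom_eq_0_imp_less\<close>). Admissible costs respect
  the componentwise order of feature vectors (\<open>admissible_costs_mono\<close>), so each
  threshold met by \<xi>' is met by \<xi>, whatever the unknown aspirations are.\<close>

lemma subdom_eq_0_iff:
  "subdom f \<alpha> \<xi> \<xi>' = 0 \<longleftrightarrow> (\<forall>k. \<alpha> $ k * (f \<xi> $ k - f \<xi>' $ k) + 1 \<le> 0)"
proof -
  have "subdom f \<alpha> \<xi> \<xi>' = 0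
      \<longleftrightarrow> (\<forall>k\<in>UNIV. pos_part (\<alpha> $ k * (f \<xi> $ k - f \<xi>' $ k) + 1) = 0)"
    unfolding subdom_def by (rule sum_nonneg_eq_0_iff) (auto simp: pos_part_def)
  then show ?thesis
    by (simp add: pos_part_def max_def)
qed

text \<open>The margin 1 inside the hinge is what makes the gap strictly negative; positivity of the
  weight then transfers the sign to the feature difference.\<close>

lemma subdom_eq_0_imp_less:
  assumes "subdom f \<alpha> \<xi> \<xi>' = 0" "0 < \<alpha> $ k"
  shows "f \<xi> $ k < f \<xi>' $ k"
proof -
  have "\<alpha> $ k * (f \<xi> $ k - f \<xi>' $ k) + 1 \<le> 0"
    using assms(1) unfolding subdom_eq_0_iff by blast
  then have "\<alpha> $ k * (f \<xi> $ k - f \<xi>' $ k) < 0"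
    by linarith
  then show ?thesis
    using assms(2) by (simp add: mult_less_0_iff)
qed

text \<open>A combination with nonnegative weights of monotone functions is monotone in each
  feature.\<close>

lemma admissible_costs_mono:
  assumes "c \<in> admissible_costs f" "\<And>k. 0 \<le> f \<xi> $ k" "\<And>k. f \<xi> $ k \<le> f \<xi>' $ k"
  shows "c \<xi> \<le> c \<xi>'"
proof -
  obtain w g where c: "c = cost f w g" and w: "\<And>k. 0 \<le> w $ k"
    and g: "\<And>k. mono_on {0..} (g k)"
    using assms(1) unfolding admissible_costs_def by blast
  \<comment> \<open>Both arguments lie in \<open>{0..}\<close>, the only region where
    \<open>g k\<close> is known to be monotone: the first by assumption, the second because it is at
    least the first.\<close>
  have "g k (f \<xi> $ k) \<le> g k (f \<xi>' $ k)" for k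
    using assms(2,3)[of k] by (intro mono_onD[OF g]) auto
  then show ?thesis
    unfolding c cost_def by (intro sum_mono mult_left_mono w)
qed

theorem theorem2:
  fixes f :: "('s, 'a, 'k::finite) cost_features"
    and \<xi> \<xi>' :: "('s, 'a) trajectory"
    and \<Omega> :: "('s, 'a) aspiration set"
  assumes "\<And>\<zeta> k. 0 \<le> f \<zeta> $ k"
    and "\<exists>\<alpha> :: real ^ 'k. (\<forall>k. 0 < \<alpha> $ k) \<and> subdom f \<alpha> \<xi> \<xi>' = 0"
    and "\<Omega> \<subseteq> aspirations f"
    and "\<xi>' \<in> Satisf \<Omega>"
  shows "\<xi> \<in> Satisf \<Omega>"
proof -
  have less: "f \<xi> $ k < f \<xi>' $ k" for k
    using assms(2) subdom_eq_0_imp_less by blast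
  have "satisfices \<xi> A" if "A \<in> \<Omega>" for A
  proof -
    have "fst A \<in> admissible_costs f"
      using that assms(3) unfolding aspirations_def by auto
    then have "fst A \<xi> \<le> fst A \<xi>'"
      by (rule admissible_costs_mono) (rule assms(1) less_imp_le[OF less])+
    \<comment> \<open>Strictness comes from the demonstration satisficing \<open>A\<close>; the cost
      comparison itself is only weak, since weights may be zero and the \<open>g k\<close>
      constant.\<close>
    also have "\<dots> < snd A"
      using that assms(4) unfolding Satisf_def satisfices_def by blast
    finally show ?thesis
      unfolding satisfices_def .
  qed
  then show ?thesis
    unfolding Satisf_def by blast
qed

end
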